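(* Let $x\in\mathfrak{M}(\mathbb{O})=\operatorname{Im}(\mathbb{O})$ be a non-zero element, and let $\Phi_t$ denote the flow on $S^7$ generated by the left-invariant vector field $X_x$. Then: (i) The operator $\operatorname{ad}(x)$ has eigenvalues $0$ (multiplicity $1$), $+i\|x\|$ (multiplicity $3$), and $-i\|x\|$ (multiplicity $3$). (ii) The one-parameter group $t\mapsto e^{t\,\operatorname{ad}(x)}$ is periodic with minimal period $T=2\pi/\|x\|$. (iii) For every $p\in S^7$, the orbit $\{\Phi_t(p):t\in\mathbb{R}\}$ is periodic, and its closure is diffeomorphic to the circle $T^1$. In particular, the dynamics on $S^7$ induced by any non-zero element of $\mathfrak{M}(\mathbb{O})$ are strictly periodic; no quasi-periodic orbits with higher-dimensional torus closures occur in this setting.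
   Context: $\mathbb{O}$ is the algebra of real octonions with inner product $\langle x,y\rangle=\operatorname{Re}(x\bar y)$ and norm $\|x\|$. $\operatorname{Im}(\mathbb{O})$ is the space of purely imaginary octonions with bracket $[x,y]=\tfrac12(xy-yx)$, and $\operatorname{ad}(x)\colon y\mapsto[x,y]$ on $\operatorname{Im}(\mathbb{O})$; eigenvalues are complex eigenvalues (of the complexification). $S^7\subset\mathbb{O}$ is the Moufang loop of unit octonions under octonion multiplication $\circ$, with $T_1S^7=\operatorname{Im}(\mathbb{O})$ and exponential map $\exp\colon\operatorname{Im}(\mathbb{O})\to S^7$ the octonionic exponential. The paper calls left-invariant vector field generated by $x$ the field $X_x(f)(p)=\frac{d}{dt}\big|_{t=0}f(\exp(tx)\circ p)$, whose flow is $\Phi_t(p)=\exp(tx)\circ p$. *)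

theory Defs
  imports "HOL-Analysis.Analysis"
begin

section \<open>Octonions\<close>

text \<open>
  Octonions are obtained from the complex numbers by two Cayley--Dickson doublings.  As the
  carriers are iterated products, the inner product, norm and topology of the octonions are those
  of the product instances, i.e. the Euclidean ones on \<open>\<real>\<^sup>8\<close>; cf. \<open>inner_octonion\<close> below.
\<close>

type_synonym quaternion = "complex \<times> complex"
type_synonym octonion = "quaternion \<times> quaternion"

definition qcnj :: "quaternion \<Rightarrow> quaternion" where
  "qcnj = (\<lambda>(a, b). (cnj a, - b))"

definition qmult :: "quaternion \<Rightarrow> quaternion \<Rightarrow> quaternion" where
  "qmult = (\<lambda>(a, b) (c, d). (a * c - cnj d * b, d * a + b * cnj c))"

definition ocnj :: "octonion \<Rightarrow> octonion" where
  "ocnj = (\<lambda>(p, q). (qcnj p, - q))"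

definition omult :: "octonion \<Rightarrow> octonion \<Rightarrow> octonion" (infixl \<open>\<odot>\<close> 70) where
  "omult = (\<lambda>(p, q) (r, s). (qmult p r - qmult (qcnj s) q, qmult s p + qmult q (qcnj r)))"

definition oone :: octonion where
  "oone = ((1, 0), (0, 0))"

definition oRe :: "octonion \<Rightarrow> real" where
  "oRe x = Re (fst (fst x))"

definition ImO :: "octonion set" where
  "ImO = {x. oRe x = 0}"

definition S7 :: "octonion set" where
  "S7 = {p. norm p = 1}"

definition ad :: "octonion \<Rightarrow> octonion \<Rightarrow> octonion" where
  "ad x y = (1/2) *\<^sub>R (x \<odot> y - y \<odot> x)"

primrec opow :: "octonion \<Rightarrow> nat \<Rightarrow> octonion" where
  "opow x 0 = oone"
| "opow x (Suc n) = x \<odot> opow x n"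

definition oexp :: "octonion \<Rightarrow> octonion" where
  "oexp x = (\<Sum>n. (1 / fact n) *\<^sub>R opow x n)"


section \<open>Eigenvalues of the complexification\<close>

text \<open>
  The complexification of a real space \<open>V\<close> is \<open>V \<times> V\<close>, with \<open>(u, v)\<close> standing for \<open>u + i v\<close>.
\<close>

definition cscale :: "complex \<Rightarrow> 'a::real_vector \<times> 'a \<Rightarrow> 'a \<times> 'a" where
  "cscale c = (\<lambda>(u, v). (Re c *\<^sub>R u - Im c *\<^sub>R v, Re c *\<^sub>R v + Im c *\<^sub>R u))"

interpretation complexification: vector_space cscale
  by unfold_locales
    (auto simp: cscale_def algebra_simps split: prod.splits)

definition complexify :: "('a \<Rightarrow> 'a) \<Rightarrow> 'a \<times> 'a \<Rightarrow> 'a \<times> 'a" where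
  "complexify A = (\<lambda>(u, v). (A u, A v))"

definition eigenspace :: "'a::real_vector set \<Rightarrow> ('a \<Rightarrow> 'a) \<Rightarrow> complex \<Rightarrow> ('a \<times> 'a) set" where
  "eigenspace V A c = {z \<in> V \<times> V. complexify A z = cscale c z}"

definition generalized_eigenspace ::
    "'a::real_vector set \<Rightarrow> ('a \<Rightarrow> 'a) \<Rightarrow> complex \<Rightarrow> ('a \<times> 'a) set" where
  "generalized_eigenspace V A c =
     {z \<in> V \<times> V. \<exists>k. ((\<lambda>w. complexify A w - cscale c w) ^^ k) z = 0}"

definition eigenvalues :: "'a::real_vector set \<Rightarrow> ('a \<Rightarrow> 'a) \<Rightarrow> complex set" where
  "eigenvalues V A = {c. \<exists>z \<in> eigenspace V A c. z \<noteq> 0}"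

text \<open>
  The dimensions are over the complex numbers.  The dimension of the generalized eigenspace is the
  multiplicity of \<open>c\<close> as a root of the characteristic polynomial.
\<close>

definition geometric_multiplicity ::
    "'a::real_vector set \<Rightarrow> ('a \<Rightarrow> 'a) \<Rightarrow> complex \<Rightarrow> nat" where
  "geometric_multiplicity V A c = complexification.dim (eigenspace V A c)"

definition algebraic_multiplicity ::
    "'a::real_vector set \<Rightarrow> ('a \<Rightarrow> 'a) \<Rightarrow> complex \<Rightarrow> nat" where
  "algebraic_multiplicity V A c = complexification.dim (generalized_eigenspace V A c)"


section \<open>Operator exponential and periods\<close>

definition op_exp :: "('a::real_normed_vector \<Rightarrow> 'a) \<Rightarrow> 'a \<Rightarrow> 'a" where
  "op_exp A y = (\<Sum>n. (1 / fact n) *\<^sub>R (A ^^ n) y)"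

text \<open>A curve with a minimal period is in particular not constant.\<close>

definition has_minimal_period :: "(real \<Rightarrow> 'a) \<Rightarrow> real \<Rightarrow> bool" where
  "has_minimal_period c T \<longleftrightarrow>
     0 < T \<and> (\<forall>t. c (t + T) = c t) \<and> (\<forall>S. 0 < S \<and> S < T \<longrightarrow> (\<exists>t. c (t + S) \<noteq> c t))"


section \<open>Smooth maps between subsets of Euclidean spaces\<close>

text \<open>\<open>Ck_on k f U\<close> is only meant for open \<open>U\<close>.\<close>

primrec Ck_on ::
    "nat \<Rightarrow> ('a::real_normed_vector \<Rightarrow> 'b::real_normed_vector) \<Rightarrow> 'a set \<Rightarrow> bool" where
  "Ck_on 0 f U \<longleftrightarrow> continuous_on U f"
| "Ck_on (Suc k) f U \<longleftrightarrow>
     (\<forall>x\<in>U. f differentiable (at x)) \<and> (\<forall>v. Ck_on k (\<lambda>x. frechet_derivative f (at x) v) U)"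

text \<open>
  On an arbitrary subset, smooth means locally extensible to a smooth map on an open subset of
  the ambient space.  For embedded submanifolds this is smoothness in the intrinsic sense, and a
  set that is diffeomorphic in this sense to a submanifold is itself an embedded submanifold.
\<close>

definition smooth_map_on ::
    "'a::real_normed_vector set \<Rightarrow> ('a \<Rightarrow> 'b::real_normed_vector) \<Rightarrow> bool" where
  "smooth_map_on S f \<longleftrightarrow>
     (\<forall>x\<in>S. \<exists>U F. open U \<and> x \<in> U \<and> (\<forall>k. Ck_on k F U) \<and> (\<forall>y\<in>U \<inter> S. f y = F y))"

definition diffeomorphic ::
    "'a::real_normed_vector set \<Rightarrow> 'b::real_normed_vector set \<Rightarrow> bool" where
  "diffeomorphic S T \<longleftrightarrow>
     (\<exists>f g. smooth_map_on S f \<and> smooth_map_on T g \<and> f ` S = T \<and> g ` T = S \<and>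
        (\<forall>x\<in>S. g (f x) = x) \<and> (\<forall>y\<in>T. f (g y) = y))"

definition circle :: "complex set" where
  "circle = sphere 0 1"

definition torus_topology :: "nat \<Rightarrow> (nat \<Rightarrow> complex) topology" where
  "torus_topology k = product_topology (\<lambda>_. top_of_set circle) {..<k}"


section \<open>Vector fields on the unit sphere and their flows\<close>

text \<open>
  A vector field on the unit sphere is given by its action on smooth functions.  Functions on
  the sphere are represented by functions on the octonions, of which only the values on the
  sphere matter.
\<close>

type_synonym derivation = "(octonion \<Rightarrow> real) \<Rightarrow> octonion \<Rightarrow> real"

definition left_invariant_field :: "octonion \<Rightarrow> derivation" where
  "left_invariant_field x f p = deriv (\<lambda>t. f (oexp (t *\<^sub>R x) \<odot> p)) 0"

definition is_flow_of :: "derivation \<Rightarrow> (real \<Rightarrow> octonion \<Rightarrow> octonion) \<Rightarrow> bool" where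
  "is_flow_of X \<Phi> \<longleftrightarrow>
     (\<forall>p\<in>S7. \<Phi> 0 p = p \<and> (\<forall>t. \<Phi> t p \<in> S7) \<and>
        (\<forall>f. smooth_map_on S7 f \<longrightarrow>
           (\<forall>t. ((\<lambda>s. f (\<Phi> s p)) has_real_derivative X f (\<Phi> t p)) (at t))))"

definition orbit :: "(real \<Rightarrow> octonion \<Rightarrow> octonion) \<Rightarrow> octonion \<Rightarrow> octonion set" where
  "orbit \<Phi> p = range (\<lambda>t. \<Phi> t p)"


section \<open>Consistency of the definitions\<close>

lemmas octonion_defs = omult_def qmult_def ocnj_def qcnj_def oone_def oRe_def

lemma inner_octonion: "x \<bullet> y = oRe (x \<odot> ocnj y)"
  by (cases x; cases y)
    (auto simp: octonion_defs inner_complex_def split: prod.splits)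

lemma octonion_cases:
  obtains a b c d e f g h where "x = ((Complex a b, Complex c d), (Complex e f, Complex g h))"
  by (metis complex.exhaust prod.exhaust)

lemma norm_omult: "norm (x \<odot> y) = norm x * norm y"
proof -
  obtain a b c d e f g h where x: "x = ((Complex a b, Complex c d), (Complex e f, Complex g h))"
    by (rule octonion_cases)
  obtain a' b' c' d' e' f' g' h'
    where y: "y = ((Complex a' b', Complex c' d'), (Complex e' f', Complex g' h'))"
    by (rule octonion_cases)
  have "(x \<odot> y) \<bullet> (x \<odot> y) = (x \<bullet> x) * (y \<bullet> y)"
    unfolding x y
    by (simp add: octonion_defs inner_complex_def complex_mult complex_diff complex_add complex_cnj
        complex_minus del: complex_surj) algebra
  then have "(norm (x \<odot> y))\<^sup>2 = (norm x * norm y)\<^sup>2"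
    by (simp add: power2_norm_eq_inner power_mult_distrib)
  then show ?thesis
    by (simp add: power2_eq_iff_nonneg)
qed

lemma omult_scaleR_left: "(c *\<^sub>R x) \<odot> y = c *\<^sub>R (x \<odot> y)"
  and omult_scaleR_right: "x \<odot> (c *\<^sub>R y) = c *\<^sub>R (x \<odot> y)"
  by (simp_all add: octonion_defs split_beta prod_eq_iff scaleR_conv_of_real algebra_simps)

lemma omult_add_left: "(x + z) \<odot> y = x \<odot> y + z \<odot> y"
  and omult_add_right: "x \<odot> (y + z) = x \<odot> y + x \<odot> z"
  by (simp_all add: octonion_defs split_beta prod_eq_iff algebra_simps)

lemma omult_one_left: "oone \<odot> y = y"
  and omult_one_right: "y \<odot> oone = y"
  by (simp_all add: octonion_defs split_beta prod_eq_iff)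

lemma ImO_omult_omult:
  assumes "x \<in> ImO"
  shows "x \<odot> (x \<odot> p) = - (norm x)\<^sup>2 *\<^sub>R p"
proof -
  obtain a b c d e f g h where x: "x = ((Complex a b, Complex c d), (Complex e f, Complex g h))"
    by (rule octonion_cases)
  obtain a' b' c' d' e' f' g' h'
    where p: "p = ((Complex a' b', Complex c' d'), (Complex e' f', Complex g' h'))"
    by (rule octonion_cases)
  have "a = 0"
    using assms by (simp add: x ImO_def oRe_def)
  then show ?thesis
    unfolding x p power2_norm_eq_inner
    by (simp add: octonion_defs inner_complex_def complex_eq_iff algebra_simps)
qed

lemma opow_sums:
  assumes "x \<in> ImO"
  shows "(\<lambda>n. (1 / fact n) *\<^sub>R opow x n) sums
           (cos (norm x) *\<^sub>R oone + (sin (norm x) / norm x) *\<^sub>R x)"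
proof -
  let ?n = "norm x"
  have pow: "(1 / fact k) *\<^sub>R opow x k
      = (cos_coeff k *\<^sub>R ?n ^ k) *\<^sub>R oone + ((sin_coeff k *\<^sub>R ?n ^ k) / ?n) *\<^sub>R x" for k
  proof -
    have *: "opow x (2 * m) = ((- 1) ^ m * ?n ^ (2 * m)) *\<^sub>R oone" for m
    proof (induction m)
      case (Suc m)
      then show ?case
        by (simp add: ImO_omult_omult[OF assms] omult_scaleR_right power2_eq_square mult.assoc)
    qed simp
    consider m where "k = 2 * m" | m where "k = Suc (2 * m)"
      by (metis oddE evenE Suc_eq_plus1)
    then show ?thesis
    proof cases
      case 1
      then show ?thesis
        by (simp add: * cos_coeff_def sin_coeff_def)
    next
      case 2
      have "opow x (Suc (2 * m)) = ((- 1) ^ m * norm x ^ (2 * m)) *\<^sub>R x"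
        using *[of m] by (simp add: omult_scaleR_right omult_one_right)
      then show ?thesis
        unfolding 2 by (cases "x = 0") (simp_all add: cos_coeff_def sin_coeff_def del: opow.simps)
    qed
  qed
  show ?thesis
    unfolding pow
    by (rule sums_add[OF sums_scaleR_left[OF cos_converges]
          sums_scaleR_left[OF sums_divide[OF sin_converges]]])
qed

lemma oexp_ImO:
  assumes "x \<in> ImO"
  shows "oexp x = cos (norm x) *\<^sub>R oone + (sin (norm x) / norm x) *\<^sub>R x"
  unfolding oexp_def using opow_sums[OF assms] by (rule sums_unique[symmetric])

lemma oexp_omult:
  assumes "x \<in> ImO"
  shows "oexp (t *\<^sub>R x) \<odot> p =
           cos (t * norm x) *\<^sub>R p + (sin (t * norm x) / norm x) *\<^sub>R (x \<odot> p)"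
proof -
  have "t *\<^sub>R x \<in> ImO"
    using assms by (simp add: ImO_def oRe_def)
  then have "oexp (t *\<^sub>R x) = cos (t * norm x) *\<^sub>R oone + (sin (t * norm x) / norm x) *\<^sub>R x"
    by (cases "t \<ge> 0") (auto simp: oexp_ImO)
  then show ?thesis
    by (simp only: omult_add_left omult_scaleR_left omult_one_left)
qed

lemma norm_oexp:
  assumes "x \<in> ImO"
  shows "norm (oexp x) = 1"
proof -
  have "oone \<bullet> x = 0" and one: "norm oone = 1"
    using assms by (simp_all add: ImO_def octonion_defs norm_prod_def inner_prod_def inner_complex_def)
  then have "(norm (oexp x))\<^sup>2
      = (norm (cos (norm x) *\<^sub>R oone))\<^sup>2 + (norm ((sin (norm x) / norm x) *\<^sub>R x))\<^sup>2"
    unfolding oexp_ImO[OF assms] by (intro norm_add_Pythagorean) (simp add: orthogonal_def)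
  also have "\<dots> = 1"
    by (cases "x = 0") (simp_all add: one power_mult_distrib)
  finally have "(norm (oexp x))\<^sup>2 = 1\<^sup>2"
    by simp
  then show ?thesis
    by (rule power2_eq_imp_eq) simp_all
qed

theorem is_flow_of_left_invariant_field:
  assumes x: "x \<in> ImO"
  shows "is_flow_of (left_invariant_field x) (\<lambda>t p. oexp (t *\<^sub>R x) \<odot> p)"
proof -
  let ?\<Phi> = "\<lambda>t p. oexp (t *\<^sub>R x) \<odot> p"
  have S7: "?\<Phi> t p \<in> S7" if "p \<in> S7" for t p
    using that x norm_oexp[of "t *\<^sub>R x"] by (simp add: S7_def norm_omult ImO_def oRe_def)
  have 0: "?\<Phi> 0 p = p" for p
    using oexp_omult[OF x, of 0 p] by simp
  have group: "?\<Phi> (s + t) p = ?\<Phi> s (?\<Phi> t p)" for s t p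
  proof (cases "x = 0")
    case False
    then show ?thesis
      unfolding oexp_omult[OF x]
      by (simp add: omult_add_right omult_scaleR_right ImO_omult_omult[OF x] cos_add sin_add
          distrib_right algebra_simps add_divide_distrib power2_eq_square)
  qed (use 0 in simp)
  have deriv0: "((\<lambda>s. f (?\<Phi> s q)) has_real_derivative left_invariant_field x f q) (at 0)"
    if q: "q \<in> S7" and f: "smooth_map_on S7 f" for f q
  proof -
    obtain U F where U: "open U" "q \<in> U" "\<forall>k. Ck_on k F U" "\<forall>y\<in>U \<inter> S7. f y = F y"
      using q f unfolding smooth_map_on_def by blast
    have "F differentiable (at q)"
      using U(2) U(3)[rule_format, of 1] by simp
    then obtain F' where F': "(F has_derivative F') (at (?\<Phi> 0 q))"
      unfolding 0 differentiable_def by blast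
    obtain P' where P': "((\<lambda>s. ?\<Phi> s q) has_derivative P') (at 0)"
    proof -
      have "\<exists>P'. ((\<lambda>s. ?\<Phi> s q) has_derivative P') (at 0)"
        unfolding oexp_omult[OF x] divide_inverse
        by (rule exI) (rule has_derivative_add has_derivative_scaleR has_derivative_mult
            has_derivative_cos has_derivative_sin has_derivative_const has_derivative_ident)+
      then show ?thesis
        using that by blast
    qed
    have F: "((\<lambda>s. F (?\<Phi> s q)) has_derivative (\<lambda>h. F' (P' h))) (at 0)"
      using diff_chain_at[OF P' F'] by (simp add: o_def)
    have "\<forall>\<^sub>F s in nhds 0. F (?\<Phi> s q) = f (?\<Phi> s q)"
    proof -
      have "((\<lambda>s. ?\<Phi> s q) \<longlongrightarrow> q) (at 0)"
        using has_derivative_continuous[OF P'] unfolding continuous_at 0 .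
      then have "\<forall>\<^sub>F s in at 0. ?\<Phi> s q \<in> U"
        using U(1,2) topological_tendstoD by blast
      then have "\<forall>\<^sub>F s in nhds 0. ?\<Phi> s q \<in> U"
        using U(2) 0[of q] by (simp add: eventually_nhds_conv_at)
      then show ?thesis
        using U(4) S7[OF q] by (auto elim!: eventually_mono)
    qed
    then have "\<forall>\<^sub>F s in at 0. F (?\<Phi> s q) = f (?\<Phi> s q)" "F (?\<Phi> 0 q) = f (?\<Phi> 0 q)"
      unfolding eventually_nhds_conv_at by auto
    with F have "((\<lambda>s. f (?\<Phi> s q)) has_derivative (\<lambda>h. F' (P' h))) (at 0)"
      by (rule has_derivative_transform_eventually) simp
    then have "(\<lambda>s. f (?\<Phi> s q)) differentiable (at 0)"
      unfolding differentiable_def by blast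
    then show ?thesis
      unfolding left_invariant_field_def
      using DERIV_imp_deriv real_differentiable_def by metis
  qed
  have "((\<lambda>s. f (?\<Phi> s p)) has_real_derivative left_invariant_field x f (?\<Phi> t p)) (at t)"
    if "p \<in> S7" and "smooth_map_on S7 f" for f p t
  proof -
    have "((\<lambda>s. f (?\<Phi> s (?\<Phi> t p))) has_real_derivative
        left_invariant_field x f (?\<Phi> t p)) (at (t + - t))"
      using deriv0[OF S7[OF that(1)] that(2)] by simp
    then have "((\<lambda>s. f (?\<Phi> (s + - t) (?\<Phi> t p))) has_real_derivative
        left_invariant_field x f (?\<Phi> t p)) (at t)"
      by (subst (asm) DERIV_shift)
    then show ?thesis
      unfolding group[symmetric] by simp
  qed
  then show ?thesis
    unfolding is_flow_of_def using 0 S7 by blast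
qed

end

theory Submission
  imports Defs
begin

text \<open>
  Everything rests on two identities for an imaginary octonion \<open>x\<close>.  Left multiplication by \<open>x\<close>
  squares to \<open>- (norm x)\<^sup>2\<close> on all octonions (alternativity), so \<open>x / norm x\<close> acts as an imaginary unit
  and \<open>oexp (t *\<^sub>R x)\<close> moves \<open>p\<close> around a circle with angular velocity \<open>norm x\<close>.  On \<open>ImO\<close> the bracket
  differs from the product only by the real part, whence \<open>ad_ad\<close>: the square of \<open>ad x\<close> is
  \<open>- (norm x)\<^sup>2\<close> times the orthogonal projection onto the complement of \<open>x\<close>.  In particular \<open>ad x\<close> satisfies
  \<open>A\<^sup>3 = - (norm x)\<^sup>2 A\<close>.

  This cubic has the three simple roots \<open>0\<close> and \<open>\<plusminus> \<i> norm x\<close>.  Hence there are no other eigenvalues, and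
  generalized eigenvectors are eigenvectors (\<open>generalized_eigenspace_eq\<close>), so that both kinds of
  multiplicity agree.  They are counted over the reals: a complex subspace has twice as large a real
  dimension (\<open>dim_eq_twice_complex_dim\<close>).  The kernel is the complex line spanned by \<open>x\<close>, and the
  eigenspace of \<open>\<i> norm x\<close> is a real-linear copy of the 6-dimensional orthogonal complement of \<open>x\<close>
  in \<open>ImO\<close>; replacing \<open>x\<close> by \<open>- x\<close> gives the third one.

  The cubic also sums the exponential series of \<open>t *\<^sub>R ad x\<close> to a constant plus a cosine and a sine
  term (\<open>op_exp_scaleR_cube\<close>), which exhibits the period; any non-zero vector of \<open>ImO\<close> orthogonal to
  \<open>x\<close> is rotated and shows that no shorter period is possible.

  A flow of the field is determined by its derivation: the coordinate functions are smooth, so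
  the difference \<open>d\<close> of two integral curves with the same initial value satisfies \<open>d' = x \<odot> d\<close>, and
  since \<open>x \<odot> d\<close> is orthogonal to \<open>d\<close>, its norm is constantly \<open>0\<close> (\<open>flow_unique\<close>).  Every orbit is
  therefore a round unit circle in the plane of \<open>p\<close> and \<open>x \<odot> p\<close>; it is compact, and linear maps
  in both directions identify it with the circle in the complex plane.  Finally, a torus of dimension
  at least 2 is not a circle, because it properly contains a circle, whereas an injective continuous
  self-map of the circle is onto (\<open>inj_circle_onto\<close>).
\<close>

section \<open>Imaginary octonions and their adjoint operators\<close>

lemma linear_ad: "linear (ad x)"
  by (rule linearI)
    (simp_all add: ad_def omult_add_left omult_add_right omult_scaleR_left omult_scaleR_right
      algebra_simps)

lemma subspace_ImO: "subspace ImO"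
  by (auto simp: subspace_def ImO_def oRe_def)

lemma ImO_iff_orthogonal_one: "y \<in> ImO \<longleftrightarrow> oone \<bullet> y = 0"
  by (simp add: ImO_def octonion_defs inner_prod_def inner_complex_def)

lemma norm_oone: "norm oone = 1"
  by (simp add: oone_def norm_prod_def)

text \<open>
  The commutator removes the real part of the product of two imaginary octonions, and that real part
  is minus the inner product.
\<close>

lemma ad_eq:
  assumes "x \<in> ImO" "y \<in> ImO"
  shows "ad x y = x \<odot> y + (x \<bullet> y) *\<^sub>R oone"
proof -
  obtain a b c d e f g h where x: "x = ((Complex a b, Complex c d), (Complex e f, Complex g h))"
    by (rule octonion_cases)
  obtain a' b' c' d' e' f' g' h'
    where y: "y = ((Complex a' b', Complex c' d'), (Complex e' f', Complex g' h'))"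
    by (rule octonion_cases)
  have "a = 0" "a' = 0"
    using assms by (simp_all add: x y ImO_def oRe_def)
  then show ?thesis
    unfolding x y ad_def
    by (simp add: octonion_defs inner_complex_def complex_eq_iff algebra_simps)
qed

text \<open>
  The squared norm of \<open>p + x \<odot> p = (oone + x) \<odot> p\<close>, expanded on the left and computed by
  multiplicativity on the right, forces the cross term to vanish, as \<open>oone\<close> and \<open>x\<close> are orthogonal.
\<close>

lemma ImO_orthogonal_omult:
  assumes "x \<in> ImO"
  shows "p \<bullet> (x \<odot> p) = 0"
proof -
  have "(norm ((oone + x) \<odot> p))\<^sup>2 = (norm p)\<^sup>2 + (norm x)\<^sup>2 * (norm p)\<^sup>2 + 2 * (p \<bullet> (x \<odot> p))"
    unfolding omult_add_left omult_one_left power_mult_distrib[symmetric] norm_omult[symmetric]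
    by (simp add: power2_norm_eq_inner inner_add_left inner_add_right inner_commute)
  moreover have "(norm (oone + x))\<^sup>2 = 1 + (norm x)\<^sup>2"
    using assms norm_add_Pythagorean[of oone x]
    by (simp add: ImO_iff_orthogonal_one orthogonal_def norm_oone)
  ultimately show ?thesis
    by (simp add: norm_omult power_mult_distrib distrib_right)
qed

lemma ad_in_ImO: "ad x y \<in> ImO"
  by (simp add: ad_def ImO_def octonion_defs split_beta algebra_simps)

lemma ad_self: "ad x x = 0"
  by (simp add: ad_def)

lemma ad_orthogonal_right:
  assumes "x \<in> ImO" "y \<in> ImO"
  shows "y \<bullet> ad x y = 0"
  using assms ImO_orthogonal_omult[of x y]
  by (simp add: ad_eq inner_add_right ImO_iff_orthogonal_one inner_commute)

lemma ad_orthogonal_left: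
  assumes "x \<in> ImO" "y \<in> ImO"
  shows "x \<bullet> ad x y = 0"
proof -
  have "ad x y = - ad y x"
    by (simp add: ad_def flip: scaleR_minus_right)
  then show ?thesis
    using ad_orthogonal_right[OF assms(2,1)] by simp
qed

text \<open>
  As \<open>ad x y\<close> is orthogonal to \<open>x\<close>, the second bracket is a plain product, and alternativity applies.
\<close>

lemma ad_ad:
  assumes "x \<in> ImO" "y \<in> ImO"
  shows "ad x (ad x y) = (x \<bullet> y) *\<^sub>R x - (norm x)\<^sup>2 *\<^sub>R y"
proof -
  have "ad x (ad x y) = x \<odot> ad x y"
    by (simp add: ad_eq[OF assms(1) ad_in_ImO] ad_orthogonal_left[OF assms])
  then show ?thesis
    by (simp add: ad_eq[OF assms] omult_add_right omult_scaleR_right omult_one_right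
        ImO_omult_omult[OF assms(1)])
qed

lemma ad_cube:
  assumes "x \<in> ImO" "y \<in> ImO"
  shows "ad x (ad x (ad x y)) = - (norm x)\<^sup>2 *\<^sub>R ad x y"
  by (simp add: ad_ad[OF assms(1) ad_in_ImO] ad_orthogonal_left[OF assms])

section \<open>Complex multiplicities from real dimensions\<close>

text \<open>
  Without the prefix of the complexification, \<open>subspace\<close> and \<open>dim\<close> are the real notions.
\<close>

lemma subspace_of_complex_subspace:
  fixes E :: "('a::real_vector \<times> 'a) set"
  assumes "complexification.subspace E"
  shows "subspace E"
proof -
  have "c *\<^sub>R z = cscale (of_real c) z" for c and z :: "'a \<times> 'a"
    by (simp add: cscale_def split_beta scaleR_prod_def)
  then show ?thesis
    using assms by (simp add: subspace_def complexification.subspace_def)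
qed

lemma dim_complex_line:
  fixes b :: "'a::euclidean_space \<times> 'a"
  assumes "b \<noteq> 0"
  shows "dim (range (\<lambda>c. cscale c b)) = 2"
proof -
  have "linear (\<lambda>c. cscale c b)"
    by (rule linearI) (simp_all add: cscale_def split_beta prod_eq_iff algebra_simps)
  moreover have "inj (\<lambda>c. cscale c b)"
    using assms by (auto intro: injI)
  ultimately show ?thesis
    using dim_image_eq[of "\<lambda>c. cscale c b" UNIV] by simp
qed

text \<open>
  Each new complex basis vector \<open>b\<close> contributes the real plane \<open>\<complex> b\<close>, which meets the span of the previous
  ones only in \<open>0\<close>.
\<close>

lemma dim_complex_span:
  fixes B :: "('a::euclidean_space \<times> 'a) set"
  assumes "finite B" "complexification.independent B"
  shows "dim (complexification.span B) = 2 * card B"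
  using assms
proof (induction B rule: finite_induct)
  case empty
  then show ?case by simp
next
  case (insert b B)
  let ?L = "range (\<lambda>c. cscale c b)"
  have ind: "complexification.independent B" and b: "b \<notin> complexification.span B"
    using insert.prems insert.hyps by (simp_all add: complexification.independent_insert)
  then have "b \<noteq> 0"
    using complexification.span_zero by metis
  have L: "complexification.span {b} = ?L"
    by (simp add: complexification.span_singleton)
  have "complexification.span (insert b B)
      = {u + v |u v. u \<in> ?L \<and> v \<in> complexification.span B}"
    using complexification.span_Un[of "{b}" B] by (simp add: L)
  moreover have "?L \<inter> complexification.span B = {0}"
  proof -
    have "cscale c b = 0" if "cscale c b \<in> complexification.span B" for c
    proof (rule ccontr)
      assume "cscale c b \<noteq> 0"
      then have "c \<noteq> 0"
        by auto
      then have "cscale (inverse c) (cscale c b) = b"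
        by simp
      then show False
        using that b complexification.span_scale by metis
    qed
    moreover have "0 \<in> ?L"
      by (rule range_eqI[of _ _ 0]) simp
    ultimately show ?thesis
      using complexification.span_zero by blast
  qed
  moreover have "subspace ?L" "subspace (complexification.span B)"
    unfolding L[symmetric]
    by (simp_all add: subspace_of_complex_subspace complexification.subspace_span)
  ultimately show ?case
    using dim_sums_Int[of ?L "complexification.span B"] insert.IH[OF ind] insert.hyps
    by (simp add: dim_complex_line[OF \<open>b \<noteq> 0\<close>])
qed

text \<open>
  Complex multiplicities thus become real dimensions, which orthogonal complements and injective
  real-linear parametrisations determine without a choice of complex bases.
\<close>

lemma dim_eq_twice_complex_dim:
  fixes E :: "('a::euclidean_space \<times> 'a) set"
  assumes "complexification.subspace E"
  shows "dim E = 2 * complexification.dim E"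
proof -
  obtain B where B: "B \<subseteq> E" "complexification.independent B" "E \<subseteq> complexification.span B"
      "card B = complexification.dim E"
    by (rule complexification.basis_exists)
  \<comment> \<open>A larger finite independent subset would span a subspace whose real dimension is too big.\<close>
  have "finite B"
  proof (rule ccontr)
    assume "infinite B"
    then obtain C where C: "C \<subseteq> B" "finite C" "card C = Suc (DIM('a \<times> 'a))"
      using infinite_arbitrarily_large by blast
    then have "dim (complexification.span C) = 2 * Suc (DIM('a \<times> 'a))"
      using B(2) complexification.independent_mono dim_complex_span by metis
    then show False
      using dim_subset_UNIV[of "complexification.span C"] by simp
  qed
  moreover have "E = complexification.span B"
    using B assms complexification.span_minimal by blast
  ultimately show ?thesis
    using B dim_complex_span by metis
qed

section \<open>Eigenvalues of operators with cube a negative multiple of themselves\<close>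

lemma complexify_add: "linear A \<Longrightarrow> complexify A (z + w) = complexify A z + complexify A w"
  by (simp add: complexify_def split_beta linear_add prod_eq_iff)

lemma complexify_cscale: "linear A \<Longrightarrow> complexify A (cscale c z) = cscale c (complexify A z)"
  by (simp add: complexify_def cscale_def split_beta linear_add linear_diff linear_scale)

lemma complexify_zero: "linear A \<Longrightarrow> complexify A 0 = 0"
  by (simp add: complexify_def split_beta linear_0 prod_eq_iff)

lemma complex_subspace_Times:
  assumes "subspace V"
  shows "complexification.subspace (V \<times> V)"
  using assms
  by (auto simp: complexification.subspace_def subspace_def cscale_def zero_prod_def
      intro!: subspace_diff[OF assms])

lemma complex_subspace_eigenspace:
  assumes "linear A" "subspace V"
  shows "complexification.subspace (eigenspace V A c)"
proof -
  note VV = complex_subspace_Times[OF assms(2)]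
  show ?thesis
    unfolding eigenspace_def
    using complexification.subspace_0[OF VV] complexification.subspace_add[OF VV]
      complexification.subspace_scale[OF VV]
    by (intro complexification.subspaceI)
      (simp_all del: mem_Sigma_iff add: complexify_add complexify_cscale complexify_zero assms(1)
        complexification.scale_right_distrib mult.commute)
qed

lemma eigenvalue_iff_complex_dim:
  fixes V :: "'a::euclidean_space set"
  assumes "linear A" "subspace V"
  shows "c \<in> eigenvalues V A \<longleftrightarrow> geometric_multiplicity V A c \<noteq> 0"
proof -
  have "dim (eigenspace V A c) = 2 * geometric_multiplicity V A c"
    unfolding geometric_multiplicity_def
    by (intro dim_eq_twice_complex_dim complex_subspace_eigenspace assms)
  then have "geometric_multiplicity V A c = 0 \<longleftrightarrow> eigenspace V A c \<subseteq> {0}"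
    by (metis dim_eq_0 mult_eq_0_iff zero_neq_numeral)
  then show ?thesis
    by (auto simp: eigenvalues_def)
qed

text \<open>
  Used with \<open>ad (- x) = - ad x\<close>, this transfers the multiplicity of \<open>\<i> norm x\<close> to its conjugate.
\<close>

lemma eigenspace_uminus:
  fixes V :: "'a::real_vector set"
  shows "eigenspace V (\<lambda>y. - A y) c = eigenspace V A (- c)"
proof -
  have "complexify (\<lambda>y. - A y) z = cscale c z \<longleftrightarrow> complexify A z = cscale (- c) z" for z
    by (auto simp: complexify_def cscale_def split_beta prod_eq_iff minus_equation_iff[of "A _"])
  then show ?thesis
    by (simp add: eigenspace_def)
qed

text \<open>
  An operator annihilated by \<open>X\<^sup>3 + r\<^sup>2 X = X (X - \<i> r) (X + \<i> r)\<close>, a polynomial with simple roots.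
\<close>

context
  fixes A :: "'a::euclidean_space \<Rightarrow> 'a" and V :: "'a set" and r :: real
  assumes A: "linear A" and V: "subspace V" "A ` V \<subseteq> V"
    and cube: "\<And>v. v \<in> V \<Longrightarrow> A (A (A v)) = - r\<^sup>2 *\<^sub>R A v" and r: "r \<noteq> 0"
begin

lemma complexify_cube:
  assumes "z \<in> V \<times> V"
  shows "complexify A (complexify A (complexify A z)) = cscale (- (of_real r)\<^sup>2) (complexify A z)"
  using assms by (auto simp: complexify_def cscale_def cube power2_eq_square)

lemma eigenvalue_cubic:
  assumes "c \<in> eigenvalues V A"
  shows "c \<in> {0, \<i> * of_real r, - (\<i> * of_real r)}"
proof -
  obtain z where z: "z \<in> V \<times> V" "complexify A z = cscale c z" "z \<noteq> 0"
    using assms by (auto simp: eigenvalues_def eigenspace_def)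
  then have "cscale (c * c * c) z = cscale (- (of_real r)\<^sup>2 * c) z"
    using complexify_cube[OF z(1)] by (simp add: complexify_cscale[OF A])
  then have "c * c * c = - (of_real r)\<^sup>2 * c"
    using z(3) complexification.scale_right_imp_eq by blast
  then have "c * ((c - \<i> * of_real r) * (c + \<i> * of_real r)) = 0"
    by (simp add: algebra_simps power2_eq_square)
  then show ?thesis
    by (auto simp: eq_neg_iff_add_eq_0)
qed

text \<open>
  Let \<open>P = X\<^sup>3 + r\<^sup>2 X\<close> and let \<open>c\<close> be one of its roots.  If \<open>u = (B - c) w\<close> is an eigenvector for \<open>c\<close>, then
  Taylor expansion gives \<open>0 = P(B) w = P(c) w + P'(c) u = (3 c\<^sup>2 + r\<^sup>2) u\<close>, and as \<open>c\<close> is a simple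
  root, \<open>u = 0\<close>.  So the powers of \<open>B - c\<close> have no larger kernel than \<open>B - c\<close> itself.
\<close>

lemma generalized_eigenspace_eq:
  assumes c: "c \<in> {0, \<i> * of_real r, - (\<i> * of_real r)}"
  shows "generalized_eigenspace V A c = eigenspace V A c"
proof -
  let ?B = "complexify A" and ?N = "\<lambda>w. complexify A w - cscale c w"
  have VV: "complexification.subspace (V \<times> V)"
    by (rule complex_subspace_Times[OF V(1)])
  have c3: "c * c * c = - (of_real r)\<^sup>2 * c" and deriv: "c * c + c * c + c * c \<noteq> - (of_real r)\<^sup>2"
    using c r by (auto simp: algebra_simps power2_eq_square)
  have N_in: "?N w \<in> V \<times> V" if "w \<in> V \<times> V" for w
    using that V(2) complexification.subspace_scale[OF VV]
    by (intro complexification.subspace_diff[OF VV]) (auto simp: complexify_def)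
  have N_N: "?N w = 0" if w: "w \<in> V \<times> V" and 0: "?N (?N w) = 0" for w
  proof -
    define u where "u = ?N w"
    have Bu: "?B u = cscale c u"
      using 0 unfolding u_def by (rule eq_iff_diff_eq_0[THEN iffD2])
    have Bw: "?B w = u + cscale c w"
      by (simp add: u_def)
    have "?B (?B (?B w)) = cscale (c * c + c * c + c * c) u + cscale (c * c * c) w"
      by (simp only: Bw Bu complexify_add[OF A] complexify_cscale[OF A]
          complexification.scale_right_distrib complexification.scale_left_distrib
          complexification.scale_scale add.assoc mult.assoc)
    moreover have "?B (?B (?B w)) = cscale (- (of_real r)\<^sup>2) u + cscale (c * c * c) w"
      unfolding complexify_cube[OF w]
      by (simp only: Bw c3 complexification.scale_right_distrib complexification.scale_scale)
    ultimately have "cscale (c * c + c * c + c * c) u = cscale (- (of_real r)\<^sup>2) u"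
      by (metis add_right_cancel)
    then have "u = 0"
      using deriv complexification.scale_right_imp_eq by blast
    then show ?thesis
      by (simp only: u_def)
  qed
  have "?N w = 0" if "w \<in> V \<times> V" "(?N ^^ k) w = 0" for k w
    using that
  proof (induction k arbitrary: w)
    case 0
    then show ?case
      by (simp add: complexify_zero[OF A])
  next
    case (Suc k)
    have "(?N ^^ k) (?N w) = 0"
      using Suc.prems(2) by (simp only: funpow_Suc_right comp_apply)
    then have "?N (?N w) = 0"
      by (rule Suc.IH[OF N_in[OF Suc.prems(1)]])
    then show ?case
      by (rule N_N[OF Suc.prems(1)])
  qed
  moreover have "(?N ^^ 1) w = 0" if "?N w = 0" for w
    using that by simp
  ultimately have "(\<exists>k. (?N ^^ k) w = 0) \<longleftrightarrow> ?B w = cscale c w" if "w \<in> V \<times> V" for w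
    unfolding right_minus_eq[symmetric, of "?B w"] using that by blast
  then show ?thesis
    unfolding generalized_eigenspace_def eigenspace_def by blast
qed

end

section \<open>The spectrum of the adjoint operator\<close>

lemma ad_uminus: "ad (- x) = (\<lambda>y. - ad x y)"
  using omult_scaleR_left[of "-1" x] omult_scaleR_right[of _ "-1" x]
  by (simp add: ad_def fun_eq_iff algebra_simps)

text \<open>
  These are the octonions orthogonal to the plane spanned by \<open>oone\<close> and \<open>x\<close> in an 8-dimensional space.
\<close>

lemma dim_ImO_orthogonal:
  assumes "x \<in> ImO" "x \<noteq> 0"
  shows "dim {u \<in> ImO. x \<bullet> u = 0} = 6"
proof -
  let ?S = "{oone, x}"
  have ne: "oone \<noteq> 0"
    using norm_oone by auto
  have orth: "oone \<bullet> x = 0"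
    using assms by (simp add: ImO_iff_orthogonal_one)
  then have "oone \<noteq> x"
    using ne by auto
  have "independent ?S"
    using orth assms(2) ne
    by (intro pairwise_orthogonal_independent)
      (auto simp: pairwise_insert orthogonal_def inner_commute)
  then have "dim (span ?S) = 2"
    using \<open>oone \<noteq> x\<close> dim_eq_card_independent[of ?S] by simp
  moreover have "{u \<in> ImO. x \<bullet> u = 0} = {y \<in> UNIV. \<forall>v \<in> span ?S. orthogonal v y}"
    by (auto simp: ImO_iff_orthogonal_one orthogonal_def inner_commute span_base
        intro: orthogonal_to_span[unfolded orthogonal_def])
  moreover have "dim (UNIV :: octonion set) = 8"
    by simp
  ultimately show ?thesis
    using dim_subspace_orthogonal_to_vectors[of "span ?S" UNIV] by simp
qed

lemma ad_eq_0_iff: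
  assumes "x \<in> ImO" "x \<noteq> 0" "y \<in> ImO"
  shows "ad x y = 0 \<longleftrightarrow> (\<exists>a. y = a *\<^sub>R x)"
proof
  assume "ad x y = 0"
  then have "(norm x)\<^sup>2 *\<^sub>R y = (x \<bullet> y) *\<^sub>R x"
    using ad_ad[OF assms(1,3)] by (simp add: linear_0[OF linear_ad])
  from arg_cong[OF this, of "scaleR (1 / (norm x)\<^sup>2)"]
  have "y = ((x \<bullet> y) / (norm x)\<^sup>2) *\<^sub>R x"
    using assms(2) by simp
  then show "\<exists>a. y = a *\<^sub>R x"
    by blast
qed (auto simp: linear_scale[OF linear_ad] ad_self)

lemma geometric_multiplicity_ad_zero:
  assumes "x \<in> ImO" "x \<noteq> 0"
  shows "geometric_multiplicity ImO (ad x) 0 = 1"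
proof -
  have "eigenspace ImO (ad x) 0 = range (\<lambda>c. cscale c (x, 0))"
  proof (intro set_eqI iffI)
    fix z
    assume "z \<in> eigenspace ImO (ad x) 0"
    then have "fst z \<in> ImO" "snd z \<in> ImO" and "complexify (ad x) z = 0"
      by (simp_all add: eigenspace_def mem_Times_iff)
    moreover from this(3) have "ad x (fst z) = 0" "ad x (snd z) = 0"
      by (simp_all add: complexify_def split_beta prod_eq_iff[of _ "0 :: octonion \<times> octonion"])
    ultimately obtain a b where "fst z = a *\<^sub>R x" "snd z = b *\<^sub>R x"
      using ad_eq_0_iff[OF assms] by blast
    then have "z = (a *\<^sub>R x, b *\<^sub>R x)"
      by (metis prod.collapse)
    then show "z \<in> range (\<lambda>c. cscale c (x, 0))"
      by (intro range_eqI[of _ _ "Complex a b"]) (simp add: cscale_def)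
  next
    fix z
    assume "z \<in> range (\<lambda>c. cscale c (x, 0))"
    then obtain c where "z = (Re c *\<^sub>R x, Im c *\<^sub>R x)"
      by (auto simp: cscale_def)
    then show "z \<in> eigenspace ImO (ad x) 0"
      using subspace_scale[OF subspace_ImO assms(1)]
      by (simp add: eigenspace_def complexify_def ad_self linear_scale[OF linear_ad]
          prod_eq_iff[of _ "0 :: octonion \<times> octonion"])
  qed
  then show ?thesis
    using dim_complex_line[of "(x, 0)"] assms(2)
      dim_eq_twice_complex_dim[OF complex_subspace_eigenspace[OF linear_ad subspace_ImO], of x 0]
    by (simp add: geometric_multiplicity_def zero_prod_def)
qed

text \<open>
  A pair \<open>(u, v)\<close>, standing for \<open>u + \<i> v\<close>, is an eigenvector for \<open>\<i> n\<close>, where \<open>n = norm x\<close>, iff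
  \<open>ad x u = - n v\<close> and \<open>ad x v = n u\<close>.  The second equation makes \<open>u\<close> orthogonal to \<open>x\<close>, the first one
  determines \<open>v\<close> from \<open>u\<close>, and conversely every such \<open>u\<close> occurs by \<open>ad_ad\<close>.  So \<open>u\<close> ranges over a real space
  of dimension 6.
\<close>

lemma geometric_multiplicity_ad_ii:
  assumes "x \<in> ImO" "x \<noteq> 0"
  shows "geometric_multiplicity ImO (ad x) (\<i> * of_real (norm x)) = 3"
proof -
  let ?n = "norm x" and ?W = "{u \<in> ImO. x \<bullet> u = 0}"
  let ?\<psi> = "\<lambda>u. (u, - (1 / norm x) *\<^sub>R ad x u)"
  have "eigenspace ImO (ad x) (\<i> * of_real ?n) = ?\<psi> ` ?W"
  proof (intro set_eqI iffI)
    fix z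
    assume z: "z \<in> eigenspace ImO (ad x) (\<i> * of_real ?n)"
    then obtain u v where uv: "z = (u, v)" "u \<in> ImO" "ad x u = - ?n *\<^sub>R v" "ad x v = ?n *\<^sub>R u"
      by (auto simp: eigenspace_def complexify_def cscale_def)
    then have "x \<bullet> (?n *\<^sub>R u) = 0"
      using z ad_orthogonal_left[OF assms(1)] by (metis (no_types, lifting) SigmaE2 eigenspace_def mem_Collect_eq)
    then have "u \<in> ?W"
      using uv assms(2) by simp
    moreover have "z = ?\<psi> u"
      using uv assms(2) by simp
    ultimately show "z \<in> ?\<psi> ` ?W"
      by blast
  next
    fix z
    assume "z \<in> ?\<psi> ` ?W"
    then obtain u where u: "u \<in> ImO" "x \<bullet> u = 0" "z = ?\<psi> u"
      by blast
    have "ad x (- (1 / ?n) *\<^sub>R ad x u) = ?n *\<^sub>R u"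
      using assms u by (simp add: linear_scale[OF linear_ad] linear_neg[OF linear_ad] ad_ad power2_eq_square)
    moreover have "- (1 / ?n) *\<^sub>R ad x u \<in> ImO"
      by (rule subspace_scale[OF subspace_ImO ad_in_ImO])
    ultimately show "z \<in> eigenspace ImO (ad x) (\<i> * of_real ?n)"
      using assms(2) u by (simp add: eigenspace_def complexify_def cscale_def)
  qed
  moreover have "dim (?\<psi> ` ?W) = 6"
  proof -
    have "linear ?\<psi>"
      by (rule linearI)
        (simp_all add: linear_add[OF linear_ad] linear_scale[OF linear_ad] algebra_simps)
    then show ?thesis
      using dim_ImO_orthogonal[OF assms] dim_image_eq[of ?\<psi> ?W] by (simp add: inj_on_def)
  qed
  ultimately show ?thesis
    using dim_eq_twice_complex_dim[OF complex_subspace_eigenspace[OF linear_ad subspace_ImO],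
        of x "\<i> * of_real ?n"]
    by (simp add: geometric_multiplicity_def)
qed

lemma spectrum_ad:
  assumes x: "x \<in> ImO" "x \<noteq> 0"
  shows "eigenvalues ImO (ad x) = {0, \<i> * of_real (norm x), - (\<i> * of_real (norm x))} \<and>
      (\<forall>mult \<in> {geometric_multiplicity, algebraic_multiplicity}.
         mult ImO (ad x) 0 = 1 \<and>
         mult ImO (ad x) (\<i> * of_real (norm x)) = 3 \<and>
         mult ImO (ad x) (- (\<i> * of_real (norm x))) = 3)"
proof -
  let ?E = "{0, \<i> * of_real (norm x), - (\<i> * of_real (norm x))}"
  have "- x \<in> ImO" "- x \<noteq> 0"
    using x subspace_neg[OF subspace_ImO] by auto
  from geometric_multiplicity_ad_ii[OF this]
  have minus: "geometric_multiplicity ImO (ad x) (- (\<i> * of_real (norm x))) = 3"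
    by (simp add: geometric_multiplicity_def ad_uminus eigenspace_uminus)
  note geometric = geometric_multiplicity_ad_zero[OF x] geometric_multiplicity_ad_ii[OF x] minus
  have range: "ad x ` ImO \<subseteq> ImO"
    using ad_in_ImO by blast
  have "norm x \<noteq> 0"
    using x by simp
  note cubic = linear_ad subspace_ImO range ad_cube[OF x(1)] this
  have "algebraic_multiplicity ImO (ad x) c = geometric_multiplicity ImO (ad x) c" if "c \<in> ?E" for c
    unfolding algebraic_multiplicity_def geometric_multiplicity_def
    by (simp only: generalized_eigenspace_eq[OF cubic that])
  from this[of 0] this[of "\<i> * of_real (norm x)"] this[of "- (\<i> * of_real (norm x))"]
  have algebraic: "algebraic_multiplicity ImO (ad x) 0 = 1"
      "algebraic_multiplicity ImO (ad x) (\<i> * of_real (norm x)) = 3"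
      "algebraic_multiplicity ImO (ad x) (- (\<i> * of_real (norm x))) = 3"
    by (simp_all only: geometric insert_iff simp_thms)
  have "c \<in> eigenvalues ImO (ad x)" if "c \<in> ?E" for c
    unfolding eigenvalue_iff_complex_dim[OF linear_ad subspace_ImO]
    using that by (elim insertE emptyE; hypsubst) (simp_all add: geometric)
  then have "eigenvalues ImO (ad x) = ?E"
    using eigenvalue_cubic[OF cubic] by blast
  then show ?thesis
    by (simp only: ball_simps simp_thms geometric algebraic)
qed

section \<open>Circular motions and their minimal periods\<close>

lemma cos_eq_1_first_positive:
  assumes "0 < s" "s < 2 * pi"
  shows "cos s \<noteq> 1"
proof
  assume "cos s = 1"
  then obtain k :: int where k: "s = k * (2 * pi)"
    by (auto simp: cos_one_2pi_int)
  then have "0 < k" "k < 1"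
    using assms by (auto simp: zero_less_mult_iff)
  then show False
    by simp
qed

text \<open>
  The inner product with \<open>v\<close> isolates the cosine, which takes the value \<open>1\<close> again only after a full turn.
\<close>

lemma has_minimal_period_circular:
  fixes u v w :: "'a::real_inner"
  assumes "0 < \<omega>" "v \<noteq> 0" "v \<bullet> w = 0"
    and c: "\<And>t. c t = u + cos (t * \<omega>) *\<^sub>R v + sin (t * \<omega>) *\<^sub>R w"
  shows "has_minimal_period c (2 * pi / \<omega>)"
  unfolding has_minimal_period_def
proof (intro conjI allI impI)
  show "0 < 2 * pi / \<omega>"
    using assms(1) by simp
  show "c (t + 2 * pi / \<omega>) = c t" for t
    using assms(1) by (simp add: c distrib_right)
  fix s
  assume s: "0 < s \<and> s < 2 * pi / \<omega>"
  have "c (0 + s) \<noteq> c 0"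
  proof
    assume "c (0 + s) = c 0"
    then have "cos (s * \<omega>) *\<^sub>R v + sin (s * \<omega>) *\<^sub>R w = v"
      by (simp add: c)
    then have "v \<bullet> (cos (s * \<omega>) *\<^sub>R v + sin (s * \<omega>) *\<^sub>R w) = v \<bullet> v"
      by simp
    then have "cos (s * \<omega>) = 1"
      using assms(2,3) by (simp add: inner_add_right)
    then show False
      using cos_eq_1_first_positive[of "s * \<omega>"] s assms(1) by (simp add: pos_less_divide_eq)
  qed
  then show "\<exists>t. c (t + s) \<noteq> c t"
    by blast
qed

lemma has_minimal_period_restrict:
  assumes "\<And>p t. p \<in> S \<Longrightarrow> c (t + T) p = c t p"
    and p: "p \<in> S" "has_minimal_period (\<lambda>t. c t p) T"
  shows "has_minimal_period (\<lambda>t. restrict (c t) S) T"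
proof -
  have "restrict (c s) S \<noteq> restrict (c t) S" if "c s p \<noteq> c t p" for s t
    using that p(1) by (metis restrict_apply')
  moreover have "restrict (c (t + T)) S = restrict (c t) S" for t
    using assms(1) by (auto intro: restrict_ext)
  ultimately show ?thesis
    using p(2) unfolding has_minimal_period_def by blast
qed

text \<open>
  From the first power on, the powers of \<open>A\<close> alternate between multiples of \<open>A y\<close> and \<open>A (A y)\<close>, so that
  the series splits into the sine series and the cosine series.  At order zero the cosine series
  contributes \<open>- A (A y) / r\<^sup>2\<close>, but the term is \<open>y\<close>; the constant first summand is the difference.
\<close>

lemma op_exp_scaleR_cube:
  fixes A :: "'a::real_normed_vector \<Rightarrow> 'a"
  assumes A: "linear A" and r: "r \<noteq> 0"
    and cube: "A (A (A y)) = - r\<^sup>2 *\<^sub>R A y"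
  shows "op_exp (\<lambda>z. t *\<^sub>R A z) y =
    (y + (1 / r\<^sup>2) *\<^sub>R A (A y)) + cos (t * r) *\<^sub>R (- (1 / r\<^sup>2) *\<^sub>R A (A y))
      + sin (t * r) *\<^sub>R ((1 / r) *\<^sub>R A y)"
proof -
  let ?v = "- (1 / r\<^sup>2) *\<^sub>R A (A y)" and ?w = "(1 / r) *\<^sub>R A y" and ?B = "\<lambda>z. t *\<^sub>R A z"
  have odd: "(?B ^^ (2 * m + 1)) y = ((-1) ^ m * (t * r) ^ (2 * m + 1)) *\<^sub>R ?w" for m
  proof (induction m)
    case 0
    then show ?case using r by simp
  next
    case (Suc m)
    then show ?case
      using r by (simp add: linear_scale[OF A] cube power2_eq_square)
  qed
  have even: "(?B ^^ (2 * m + 2)) y = ((-1) ^ (m + 1) * (t * r) ^ (2 * m + 2)) *\<^sub>R ?v" for m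
    using odd[of m] r by (simp add: linear_scale[OF A] power2_eq_square)
  have "(1 / fact k) *\<^sub>R (?B ^^ k) y = (if k = 0 then y - ?v else 0)
      + (cos_coeff k *\<^sub>R (t * r) ^ k) *\<^sub>R ?v + (sin_coeff k *\<^sub>R (t * r) ^ k) *\<^sub>R ?w" for k
  proof -
    have "k = 0 \<or> (\<exists>m. k = 2 * m + 2) \<or> (\<exists>m. k = 2 * m + 1)"
      by presburger
    then consider "k = 0" | m where "k = 2 * m + 2" | m where "k = 2 * m + 1"
      by blast
    then show ?thesis
    proof cases
      case 1
      then show ?thesis by simp
    next
      case 2
      show ?thesis
        unfolding 2 even by (simp add: cos_coeff_def sin_coeff_def)
    next
      case 3
      show ?thesis
        unfolding 3 odd by (simp add: cos_coeff_def sin_coeff_def)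
    qed
  qed
  then have series: "(\<lambda>k. (1 / fact k) *\<^sub>R (?B ^^ k) y) = (\<lambda>k. (if k = 0 then y - ?v else 0)
      + (cos_coeff k *\<^sub>R (t * r) ^ k) *\<^sub>R ?v + (sin_coeff k *\<^sub>R (t * r) ^ k) *\<^sub>R ?w)"
    by (rule ext)
  have "(\<lambda>k. (if k = 0 then y - ?v else 0)
      + (cos_coeff k *\<^sub>R (t * r) ^ k) *\<^sub>R ?v + (sin_coeff k *\<^sub>R (t * r) ^ k) *\<^sub>R ?w)
      sums ((y - ?v) + cos (t * r) *\<^sub>R ?v + sin (t * r) *\<^sub>R ?w)"
    by (rule sums_add[OF sums_add[OF sums_single[of 0 "\<lambda>_. y - ?v"]
            sums_scaleR_left[OF cos_converges]] sums_scaleR_left[OF sin_converges]])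
  from sums_unique[OF this] show ?thesis
    unfolding op_exp_def series by simp
qed

lemma has_minimal_period_exp_ad:
  assumes x: "x \<in> ImO" "x \<noteq> 0"
  shows "has_minimal_period (\<lambda>t. restrict (op_exp (\<lambda>y. t *\<^sub>R ad x y)) ImO) (2 * pi / norm x)"
proof -
  let ?n = "norm x"
  have n: "?n > 0" "?n \<noteq> 0"
    using x by simp_all
  have "\<not> {u \<in> ImO. x \<bullet> u = 0} \<subseteq> {0}"
    unfolding dim_eq_0[symmetric] dim_ImO_orthogonal[OF x] by simp
  \<comment> \<open>The motion of \<open>y\<close> alone already rules out a shorter period of the operators.\<close>
  then obtain y where y: "y \<in> ImO" "x \<bullet> y = 0" "y \<noteq> 0"
    by blast
  show ?thesis
  proof (rule has_minimal_period_restrict)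
    show "op_exp (\<lambda>y. (t + 2 * pi / ?n) *\<^sub>R ad x y) z = op_exp (\<lambda>y. t *\<^sub>R ad x y) z"
      if "z \<in> ImO" for z t
      using n by (simp add: op_exp_scaleR_cube[OF linear_ad n(2) ad_cube[OF x(1) that]] distrib_right)
    show "y \<in> ImO"
      by fact
    show "has_minimal_period (\<lambda>t. op_exp (\<lambda>z. t *\<^sub>R ad x z) y) (2 * pi / ?n)"
      by (rule has_minimal_period_circular[OF n(1) _ _
            op_exp_scaleR_cube[OF linear_ad n(2) ad_cube[OF x(1) y(1)]]])
        (use x y in \<open>simp_all add: ad_ad ad_orthogonal_right\<close>)
  qed
qed

section \<open>Circles and their smooth parametrisations\<close>

lemma Ck_on_const: "Ck_on k (\<lambda>_. c) U"
  by (induction k arbitrary: c) simp_all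

lemma Ck_on_bounded_linear:
  assumes "bounded_linear f"
  shows "Ck_on k f U"
proof (cases k)
  case 0
  then show ?thesis
    using assms by (simp add: linear_continuous_on)
next
  case (Suc m)
  have "(f has_derivative f) (at x)" for x
    by (rule bounded_linear_imp_has_derivative[OF assms])
  then have "f differentiable (at x)" "frechet_derivative f (at x) = f" for x
    by (auto simp: differentiable_def frechet_derivative_at[symmetric])
  then show ?thesis
    by (simp add: Suc Ck_on_const)
qed

lemma smooth_map_on_bounded_linear: "bounded_linear f \<Longrightarrow> smooth_map_on S f"
  unfolding smooth_map_on_def using Ck_on_bounded_linear open_UNIV UNIV_I by metis

lemma smooth_map_on_imp_continuous_on:
  assumes "smooth_map_on S f"
  shows "continuous_on S f"
  unfolding continuous_on_eq_continuous_within
proof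
  fix x
  assume x: "x \<in> S"
  then obtain U F where U: "open U" "x \<in> U" "\<forall>k. Ck_on k F U" "\<forall>y\<in>U \<inter> S. f y = F y"
    using assms unfolding smooth_map_on_def by blast
  have "continuous_on U F"
    using U(3)[rule_format, of 0] by simp
  then have "continuous_on (S \<inter> U) f"
    using U(4) by (metis (no_types, lifting) continuous_on_cong continuous_on_subset inf_commute inf_le1)
  then have "continuous (at x within S \<inter> U) f"
    using x U(2) by (simp add: continuous_on_eq_continuous_within)
  then show "continuous (at x within S) f"
    using at_within_nhd[of x U S "S \<inter> U"] U(1,2) by (simp add: continuous_within Int_assoc)
qed

lemma diffeomorphic_imp_homeomorphic:
  assumes "diffeomorphic S T"
  shows "S homeomorphic T"
proof -
  obtain f g where "smooth_map_on S f" "smooth_map_on T g" "f ` S = T" "g ` T = S"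
      "\<forall>x\<in>S. g (f x) = x" "\<forall>y\<in>T. f (g y) = y"
    using assms unfolding diffeomorphic_def by blast
  then have "homeomorphism S T f g"
    by (simp add: homeomorphism_def smooth_map_on_imp_continuous_on)
  then show ?thesis
    unfolding homeomorphic_def by blast
qed

lemma homeomorphic_imp_homeomorphic_space:
  assumes "S homeomorphic T"
  shows "top_of_set S homeomorphic_space top_of_set T"
  using assms
  unfolding homeomorphic_def homeomorphism_def homeomorphic_space_def homeomorphic_maps_def
  by (fastforce simp: continuous_map_in_subtopology)

lemma circle_eq_range_cis: "circle = range cis"
proof
  show "circle \<subseteq> range cis"
  proof
    fix z
    assume "z \<in> circle"
    then have "z = cis (Arg z)"
      using rcis_cmod_Arg[of z] by (simp add: circle_def rcis_def)
    then show "z \<in> range cis"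
      by blast
  qed
qed (auto simp: circle_def)

text \<open>
  The unit circle in the plane of two orthonormal vectors.  Its coordinates in that plane and the
  corresponding linear combinations are mutually inverse, and both are restrictions of linear maps
  between the ambient spaces, hence smooth.
\<close>

context
  fixes p q :: "'a::euclidean_space"
  assumes norm: "norm p = 1" "norm q = 1" and orth: "p \<bullet> q = 0"
begin

lemma diffeomorphic_orthonormal_circle:
  "diffeomorphic (range (\<lambda>t. cos t *\<^sub>R p + sin t *\<^sub>R q)) circle" (is "diffeomorphic ?S _")
proof -
  let ?f = "\<lambda>y. Complex (y \<bullet> p) (y \<bullet> q)" and ?g = "\<lambda>z. Re z *\<^sub>R p + Im z *\<^sub>R q"
  have pq: "p \<bullet> p = 1" "q \<bullet> q = 1" "q \<bullet> p = 0"
    using norm orth by (simp_all add: dot_square_norm inner_commute)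
  have fg: "?f (?g z) = z" for z
    by (simp add: pq orth inner_add_left complex_eq_iff)
  have S: "?S = ?g ` circle"
    by (simp add: circle_eq_range_cis image_image)
  have "linear ?f" "linear ?g"
    by (auto intro!: linearI simp: complex_eq_iff inner_add_left algebra_simps)
  then have "bounded_linear ?f" "bounded_linear ?g"
    by (simp_all add: linear_conv_bounded_linear)
  then have "smooth_map_on ?S ?f" "smooth_map_on circle ?g"
    by (simp_all add: smooth_map_on_bounded_linear)
  moreover have "?f ` ?S = circle"
    unfolding S image_image fg by simp
  moreover have "?g (?f (?g z)) = ?g z" for z
    by (simp only: fg)
  then have "\<forall>y\<in>?S. ?g (?f y) = y"
    unfolding S by blast
  ultimately show ?thesis
    unfolding diffeomorphic_def using fg S by blast
qed

lemma closed_orthonormal_circle: "closed (range (\<lambda>t. cos t *\<^sub>R p + sin t *\<^sub>R q))" (is "closed ?S")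
proof -
  have "?S homeomorphic circle"
    by (rule diffeomorphic_imp_homeomorphic[OF diffeomorphic_orthonormal_circle])
  then show ?thesis
    by (metis circle_def compact_imp_closed compact_sphere homeomorphic_compactness)
qed

end

text \<open>
  A circle without a point \<open>w\<close> embeds into the line, by the argument measured from \<open>- w\<close>.  A map missing
  \<open>w\<close> would thus embed a circle into the line, which the Borsuk--Ulam theorem forbids.
\<close>

lemma inj_circle_onto:
  assumes cont: "continuous_on circle f" and inj: "inj_on f circle" and range: "f ` circle \<subseteq> circle"
  shows "f ` circle = circle"
proof (rule ccontr)
  assume "f ` circle \<noteq> circle"
  then obtain w where w: "w \<in> circle" "w \<notin> f ` circle"
    using range by blast
  \<comment> \<open>The rotation by \<open>- 1 / w\<close> moves the missing point to \<open>- 1\<close>, onto the branch cut of \<open>Arg\<close>.\<close>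
  let ?h = "\<lambda>z. - (f z / w)"
  have norm: "norm (?h z) = 1" if "z \<in> circle" for z
    using w(1) range that by (simp add: image_subset_iff circle_def norm_divide)
  have slit: "?h z \<notin> \<real>\<^sub>\<le>\<^sub>0" if z: "z \<in> circle" for z
  proof
    assume "?h z \<in> \<real>\<^sub>\<le>\<^sub>0"
    then obtain r where r: "?h z = of_real r" "r \<le> 0"
      by (auto simp: nonpos_Reals_def)
    then have "r = - 1"
      using norm[OF z] by simp
    then have "f z = w"
      using r w(1) by (auto simp: circle_def field_simps split: if_splits)
    then show False
      using w(2) z by blast
  qed
  have "continuous_on circle (\<lambda>z. Arg (?h z))"
    using cont slit w(1) by (intro continuous_intros) (auto simp: circle_def)
  moreover have "inj_on (\<lambda>z. Arg (?h z)) circle"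
  proof (rule inj_onI)
    fix y z
    assume yz: "y \<in> circle" "z \<in> circle" "Arg (?h y) = Arg (?h z)"
    then have "?h y = ?h z"
      using norm rcis_cmod_Arg by metis
    then have "f y = f z"
      using w(1) by (auto simp: circle_def split: if_splits)
    then show "y = z"
      using inj yz by (simp add: inj_on_eq_iff)
  qed
  ultimately have "DIM(complex) \<le> DIM(real)"
    unfolding circle_def by (rule no_embedding_sphere_lowdim) simp
  then show False
    by simp
qed

text \<open>
  A homeomorphism from the torus would turn a coordinate circle into an injective but not surjective
  self-map of the circle.
\<close>

lemma circle_not_homeomorphic_torus:
  assumes "k \<ge> 2"
  shows "\<not> top_of_set circle homeomorphic_space torus_topology k"
proof
  assume "top_of_set circle homeomorphic_space torus_topology k"
  then obtain f g where fg: "homeomorphic_maps (top_of_set circle) (torus_topology k) f g"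
    by (auto simp: homeomorphic_space_def)
  have top: "topspace (torus_topology k) = (\<Pi>\<^sub>E i\<in>{..<k}. circle)"
    by (simp add: torus_topology_def)
  \<comment> \<open>The circle in the first coordinate direction; \<open>b\<close> below is a point of the torus off this circle.\<close>
  define j where "j z = (\<lambda>i\<in>{..<k}. if i = 0 then z else 1)" for z :: complex
  have "continuous_map (top_of_set circle) (top_of_set circle) (\<lambda>z. if i = 0 then z else 1)" for i :: nat
    by (auto simp: continuous_map_in_subtopology circle_def)
  then have j: "continuous_map (top_of_set circle) (torus_topology k) j"
    unfolding torus_topology_def continuous_map_componentwise j_def by auto
  then have g_j: "continuous_map (top_of_set circle) (top_of_set circle) (g \<circ> j)"
    using fg continuous_map_compose unfolding homeomorphic_maps_def by blast
  have inj_g: "inj_on g (topspace (torus_topology k))"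
    using fg unfolding homeomorphic_maps_def by (metis inj_on_inverseI)
  have j_in: "j ` circle \<subseteq> topspace (torus_topology k)"
    using j by (auto simp: continuous_map_def)
  have "inj_on j circle"
  proof (rule inj_onI)
    fix y z
    assume "j y = j z"
    from fun_cong[OF this, of 0] show "y = z"
      using assms by (simp add: j_def)
  qed
  then have "inj_on (g \<circ> j) circle"
    using comp_inj_on inj_on_subset[OF inj_g j_in] by blast
  then have onto: "(g \<circ> j) ` circle = circle"
    using g_j by (intro inj_circle_onto) (auto simp: continuous_map_in_subtopology)
  define b where "b = (\<lambda>i\<in>{..<k}. if i = 1 then -1 else 1 :: complex)"
  have b: "b \<in> topspace (torus_topology k)"
    by (auto simp: top b_def circle_def)
  then have "g b \<in> circle"
    using fg by (auto simp: homeomorphic_maps_def continuous_map_def)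
  then obtain z where "z \<in> circle" "g b = g (j z)"
    using onto by (metis (no_types, lifting) comp_apply imageE)
  then have "b = j z"
    using inj_g b j_in by (meson image_subset_iff inj_onD)
  from fun_cong[OF this, of 1] show False
    using assms by (simp add: b_def j_def)
qed

section \<open>The flow of a left-invariant field\<close>

lemma smooth_map_on_inner: "smooth_map_on S (\<lambda>y. y \<bullet> b)"
  by (rule smooth_map_on_bounded_linear[OF bounded_linear_inner_left])

text \<open>
  The field has the value \<open>x \<odot> q\<close> at \<open>q\<close>; here it is read off from the coordinate functions, whose
  derivatives are all that the uniqueness argument needs.
\<close>

lemma left_invariant_field_inner:
  assumes "x \<in> ImO"
  shows "left_invariant_field x (\<lambda>y. y \<bullet> b) q = (x \<odot> q) \<bullet> b"
proof -
  have "((\<lambda>t. cos (t * norm x) * (q \<bullet> b) + sin (t * norm x) / norm x * ((x \<odot> q) \<bullet> b))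
      has_real_derivative (x \<odot> q) \<bullet> b) (at 0)"
  proof (cases "x = 0")
    case True
    then have "x \<odot> q = 0"
      using omult_scaleR_left[of 0 0 q] by simp
    then show ?thesis
      using True by simp
  next
    case False
    then show ?thesis
      by (auto intro!: derivative_eq_intros)
  qed
  then show ?thesis
    unfolding left_invariant_field_def oexp_omult[OF assms] inner_add_left inner_scaleR_left
    by (rule DERIV_imp_deriv)
qed

text \<open>
  In coordinates, both curves solve the linear equation \<open>y' = x \<odot> y\<close>, hence so does their difference.
  Its squared norm has derivative \<open>2 * ((x \<odot> d) \<bullet> d) = 0\<close> and vanishes at time \<open>0\<close>.
\<close>

lemma flow_unique:
  assumes x: "x \<in> ImO" and \<Phi>: "is_flow_of (left_invariant_field x) \<Phi>" and p: "p \<in> S7"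
  shows "\<Phi> t p = oexp (t *\<^sub>R x) \<odot> p"
proof -
  define \<Psi> where "\<Psi> t p = oexp (t *\<^sub>R x) \<odot> p" for t p
  have \<Psi>: "is_flow_of (left_invariant_field x) \<Psi>"
    unfolding \<Psi>_def by (rule is_flow_of_left_invariant_field[OF x])
  have coordinate: "((\<lambda>s. \<Theta> s p \<bullet> b) has_real_derivative (x \<odot> \<Theta> s p) \<bullet> b) (at s)"
    if "is_flow_of (left_invariant_field x) \<Theta>" for \<Theta> b s
    using that p smooth_map_on_inner[of S7 b]
    by (auto simp: is_flow_of_def simp flip: left_invariant_field_inner[OF x])
  define d where "d s = \<Phi> s p - \<Psi> s p" for s
  have omult_d: "x \<odot> d s = x \<odot> \<Phi> s p - x \<odot> \<Psi> s p" for s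
    using omult_add_right[of x "d s" "\<Psi> s p"] by (simp add: d_def)
  have d: "((\<lambda>s. d s \<bullet> b) has_real_derivative (x \<odot> d s) \<bullet> b) (at s)" for b s
    unfolding omult_d unfolding d_def inner_diff_left
    by (intro DERIV_diff coordinate \<Phi> \<Psi>)
  have "((\<lambda>s. d s \<bullet> d s) has_real_derivative 0) (at s)" for s
  proof -
    have "((\<lambda>s. \<Sum>b\<in>Basis. (d s \<bullet> b) * (d s \<bullet> b)) has_real_derivative
        (\<Sum>b\<in>Basis. ((x \<odot> d s) \<bullet> b) * (d s \<bullet> b) + ((x \<odot> d s) \<bullet> b) * (d s \<bullet> b))) (at s)"
      by (intro DERIV_sum DERIV_mult d)
    then have "((\<lambda>s. d s \<bullet> d s) has_real_derivative 2 * ((x \<odot> d s) \<bullet> d s)) (at s)"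
      unfolding sum.distrib euclidean_inner[symmetric] by simp
    then show ?thesis
      using ImO_orthogonal_omult[OF x, of "d s"] by (simp add: inner_commute)
  qed
  then have "d t \<bullet> d t = d 0 \<bullet> d 0"
    using DERIV_isconst_all[of "\<lambda>s. d s \<bullet> d s"] by blast
  also have "d 0 = 0"
    using \<Phi> \<Psi> p by (simp add: d_def is_flow_of_def)
  finally show ?thesis
    by (simp add: d_def \<Psi>_def)
qed

text \<open>
  The second axis of the circle is the direction \<open>x \<odot> p\<close> in which the field pushes \<open>p\<close>.
\<close>

lemma flow_circular:
  assumes x: "x \<in> ImO" "x \<noteq> 0" and \<Phi>: "is_flow_of (left_invariant_field x) \<Phi>" and p: "p \<in> S7"
  obtains q where "norm q = 1" "p \<bullet> q = 0"
    "\<And>t. \<Phi> t p = cos (t * norm x) *\<^sub>R p + sin (t * norm x) *\<^sub>R q"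
proof
  let ?q = "(1 / norm x) *\<^sub>R (x \<odot> p)"
  show "norm ?q = 1"
    using x p by (simp add: norm_omult S7_def)
  show "p \<bullet> ?q = 0"
    using ImO_orthogonal_omult[OF x(1), of p] by simp
  show "\<Phi> t p = cos (t * norm x) *\<^sub>R p + sin (t * norm x) *\<^sub>R ?q" for t
    by (simp add: flow_unique[OF x(1) \<Phi> p] oexp_omult[OF x(1)])
qed

theorem proposition6p3:
  fixes x :: octonion and \<Phi> :: "real \<Rightarrow> octonion \<Rightarrow> octonion"
  assumes "x \<in> ImO" and "x \<noteq> 0"
    and "is_flow_of (left_invariant_field x) \<Phi>"
  shows
    "(eigenvalues ImO (ad x) = {0, \<i> * of_real (norm x), - (\<i> * of_real (norm x))} \<and>
      (\<forall>mult \<in> {geometric_multiplicity, algebraic_multiplicity}.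
         mult ImO (ad x) 0 = 1 \<and>
         mult ImO (ad x) (\<i> * of_real (norm x)) = 3 \<and>
         mult ImO (ad x) (- (\<i> * of_real (norm x))) = 3)) \<and>
     has_minimal_period (\<lambda>t. restrict (op_exp (\<lambda>y. t *\<^sub>R ad x y)) ImO) (2 * pi / norm x) \<and>
     (\<forall>p\<in>S7. (\<exists>T. has_minimal_period (\<lambda>t. \<Phi> t p) T) \<and>
        diffeomorphic (closure (orbit \<Phi> p)) circle) \<and>
     (\<exists>T. has_minimal_period (\<lambda>t. restrict (\<Phi> t) S7) T) \<and>
     \<not> (\<exists>p\<in>S7. \<exists>k\<ge>2. top_of_set (closure (orbit \<Phi> p)) homeomorphic_space torus_topology k)"
proof -
  let ?T = "2 * pi / norm x"
  have n: "norm x > 0"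
    using assms(2) by simp
  have period: "has_minimal_period (\<lambda>t. \<Phi> t p) ?T" if p: "p \<in> S7" for p
  proof -
    obtain q where q: "p \<bullet> q = 0" "\<And>t. \<Phi> t p = cos (t * norm x) *\<^sub>R p + sin (t * norm x) *\<^sub>R q"
      using flow_circular[OF assms p] by metis
    have "p \<noteq> 0"
      using p by (auto simp: S7_def)
    then show ?thesis
      using q by (intro has_minimal_period_circular[OF n, of p q _ 0]) simp_all
  qed
  have circular: "diffeomorphic (closure (orbit \<Phi> p)) circle" if p: "p \<in> S7" for p
  proof -
    obtain q where q: "norm q = 1" "p \<bullet> q = 0"
        "\<And>t. \<Phi> t p = cos (t * norm x) *\<^sub>R p + sin (t * norm x) *\<^sub>R q"
      using flow_circular[OF assms p] by metis
    have p1: "norm p = 1"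
      using p by (simp add: S7_def)
    have "range (\<lambda>t. t * norm x) = UNIV"
      using n by (intro surjI[of _ "\<lambda>s. s / norm x"]) simp
    then have "orbit \<Phi> p = range (\<lambda>t. cos t *\<^sub>R p + sin t *\<^sub>R q)"
      unfolding orbit_def q(3) by (metis (mono_tags, lifting) image_image image_cong)
    then show ?thesis
      using diffeomorphic_orthonormal_circle[OF p1 q(1,2)] closed_orthonormal_circle[OF p1 q(1,2)]
      by (simp add: closure_closed)
  qed
  have "has_minimal_period (\<lambda>t. restrict (\<Phi> t) S7) ?T"
  proof (rule has_minimal_period_restrict)
    show "\<Phi> (t + ?T) p = \<Phi> t p" if "p \<in> S7" for p t
      using period[OF that] by (simp add: has_minimal_period_def)
    show "oone \<in> S7"
      by (simp add: S7_def norm_oone)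
    then show "has_minimal_period (\<lambda>t. \<Phi> t oone) ?T"
      by (rule period)
  qed
  moreover have "\<not> top_of_set (closure (orbit \<Phi> p)) homeomorphic_space torus_topology k"
    if p: "p \<in> S7" and k: "k \<ge> 2" for p k
  proof -
    have "top_of_set circle homeomorphic_space top_of_set (closure (orbit \<Phi> p))"
      using homeomorphic_imp_homeomorphic_space diffeomorphic_imp_homeomorphic[OF circular[OF p]]
        homeomorphic_sym by blast
    then show ?thesis
      using circle_not_homeomorphic_torus[OF k] homeomorphic_space_trans by blast
  qed
  ultimately show ?thesis
    using spectrum_ad[OF assms(1,2)] has_minimal_period_exp_ad[OF assms(1,2)] period circular
    by blast
qed

end
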